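(* In the generic model, let $\mathcal P\colon H_R\to\mathbb R[x]$ be the map assigning to each $h\in H_R$ the polynomial with $\lim_{z\to0}\phi_{R,s}(h)=\mathcal P(h)\big(\ln\frac s\mu\big)$ for all $s>0$. Define $L\in\operatorname{End}(\mathbb R[x])$ by $$L(x^n)=-c_{-1}\frac{x^{n+1}}{n+1}+\sum_{i=1}^n\binom ni(-1)^{n-i}(n-i)!\,c_{n-i}\,x^i\qquad(n\ge0),$$ i.e. $L=-c_{-1}\int_0+\delta\eta$ with $\eta(x^n)=n!(-1)^nc_n$. Then $L$ is a Hochschild 1-cocycle of $\mathbb R[x]$ and $\mathcal P=\phi_L$, the unique unital algebra morphism $H_R\to\mathbb R[x]$ with $\phi_L\circ B_+=L\circ\phi_L$. Consequently $\mathcal P$ is a morphism of Hopf algebras.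
   Context: Generic model: $f\colon[0,\infty)\to\mathbb R$ continuous with $f(\zeta)-c/\zeta=O(\zeta^{-1-\epsilon})$ as $\zeta\to\infty$ for some $c\in\mathbb R,\epsilon>0$; Mellin transform $F(z)=\int_0^\infty f(\zeta)\zeta^{-z}d\zeta$ (holomorphic for $0<\operatorname{Re}z<1$, meromorphic near $0$ with Laurent expansion $F(z)=\sum_{n\ge-1}c_nz^n$). $H_R$: Connes–Kreimer Hopf algebra of rooted trees (basis rooted forests $w$, $|w|$ number of nodes, $w_v$ subtree rooted at node $v$, $B_+$ grafting onto a new root, coproduct with $\Delta\circ B_+=B_+\otimes\mathbb 1+(\mathrm{id}\otimes B_+)\circ\Delta$, antipode $S$). Regularized rules: algebra morphism $\phi_s(w)=s^{-z|w|}\prod_{v\in V(w)}F(z|w_v|)$; for fixed $\mu>0$, $\phi_{R,s}:=\phi_\mu^{\star-1}\star\phi_s$, i.e. $\phi_{R,s}(w)=\sum_w\phi_\mu(S(w_1))\phi_s(w_2)$. The limit $z\to0$ exists and is a polynomial in $\ln(s/\mu)$ (so $\mathcal P$ is well defined). $\mathbb R[x]$ carries the Hopf structure with $x$ primitive; $\int_0(x^n)=x^{n+1}/(n+1)$; for $\alpha\in\mathbb R[x]'$, $\delta\alpha=(\mathrm{id}\otimes\alpha)\circ\Delta-\mathbb 1\cdot\alpha$; a 1-cocycle is $L$ with $\Delta\circ L=(\mathrm{id}\otimes L)\circ\Delta+L\otimes\mathbb 1$. *)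

theory Defs
  imports "HOL-Analysis.Analysis" "HOL-Library.Multiset" "HOL-Library.Poly_Mapping"
    "HOL-Library.Product_Plus" "HOL-Library.Landau_Symbols"
    "HOL-Computational_Algebra.Polynomial"
begin

text \<open>Non-planar rooted trees: a node with a multiset of children.
  A rooted forest is a multiset of rooted trees (empty forest = unit 1).\<close>
datatype rtree = Node "rtree multiset"

type_synonym forest = "rtree multiset"

text \<open>H_R is the free commutative algebra on rooted trees, i.e. the monoid algebra
  of the commutative monoid of forests (product of forests = multiset union).
  H_R tensor H_R is the monoid algebra on pairs of forests (a,b) = a tensor b.\<close>
type_synonym HR = "forest \<Rightarrow>\<^sub>0 real"
type_synonym HRHR = "(forest \<times> forest) \<Rightarrow>\<^sub>0 real"

definition bas :: "forest \<Rightarrow> HR" where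
  "bas w = Poly_Mapping.single w 1"

definition Bplus :: "forest \<Rightarrow> rtree" where
  "Bplus w = Node w"

primrec tnodes :: "rtree \<Rightarrow> nat" where
  "tnodes (Node ws) = 1 + sum_mset (image_mset tnodes ws)"

definition fnodes :: "forest \<Rightarrow> nat" where
  "fnodes w = sum_mset (image_mset tnodes w)"

definition scal :: "real \<Rightarrow> ('a \<Rightarrow>\<^sub>0 real) \<Rightarrow> ('a \<Rightarrow>\<^sub>0 real)" where
  "scal c u = Poly_Mapping.map (\<lambda>x. c * x) u"

definition id_tensor_Bplus :: "HRHR \<Rightarrow> HRHR" where
  "id_tensor_Bplus u =
     (\<Sum>p\<in>Poly_Mapping.keys u. Poly_Mapping.single (fst p, {#Bplus (snd p)#}) (Poly_Mapping.lookup u p))"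

primrec cop_tree :: "rtree \<Rightarrow> HRHR" where
  "cop_tree (Node ws) =
     Poly_Mapping.single ({#Node ws#}, {#}) 1
     + id_tensor_Bplus (prod_mset (image_mset cop_tree ws))"

definition copH :: "forest \<Rightarrow> HRHR" where
  "copH w = prod_mset (image_mset cop_tree w)"

definition counitH :: "forest \<Rightarrow> real" where
  "counitH w = (if w = {#} then 1 else 0)"

text \<open>S is the antipode of H_R (given by its values on the basis forests, extended
  linearly): m o (S tensor id) o Delta = eta o eps = m o (id tensor S) o Delta.\<close>
definition is_antipodeH :: "(forest \<Rightarrow> HR) \<Rightarrow> bool" where
  "is_antipodeH S \<longleftrightarrow>
     (\<forall>w. (\<Sum>p\<in>Poly_Mapping.keys (copH w). scal (Poly_Mapping.lookup (copH w) p) (S (fst p) * bas (snd p)))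
            = scal (counitH w) 1) \<and>
     (\<forall>w. (\<Sum>p\<in>Poly_Mapping.keys (copH w). scal (Poly_Mapping.lookup (copH w) p) (bas (fst p) * S (snd p)))
            = scal (counitH w) 1)"

definition linH :: "(forest \<Rightarrow> 'v::real_vector) \<Rightarrow> HR \<Rightarrow> 'v" where
  "linH g h = (\<Sum>k\<in>Poly_Mapping.keys h. Poly_Mapping.lookup h k *\<^sub>R g k)"

definition linHpoly :: "(forest \<Rightarrow> real poly) \<Rightarrow> HR \<Rightarrow> real poly" where
  "linHpoly g h = (\<Sum>k\<in>Poly_Mapping.keys h. smult (Poly_Mapping.lookup h k) (g k))"

text \<open>R[x] tensor R[x] is represented as the free module with basis x^i tensor x^j,
  indexed by (i,j).\<close>
type_synonym RxRx = "(nat \<times> nat) \<Rightarrow>\<^sub>0 real"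

definition ptens :: "real poly \<Rightarrow> real poly \<Rightarrow> RxRx" where
  "ptens p q = (\<Sum>i\<le>degree p. \<Sum>j\<le>degree q. Poly_Mapping.single (i, j) (coeff p i * coeff q j))"

text \<open>Coproduct of R[x] with x primitive: Delta(x^n) = sum_k binom(n,k) x^k tensor x^(n-k).\<close>
definition copX :: "real poly \<Rightarrow> RxRx" where
  "copX p = (\<Sum>n\<le>degree p. \<Sum>k\<le>n. Poly_Mapping.single (k, n - k) (coeff p n * real (n choose k)))"

definition counitX :: "real poly \<Rightarrow> real" where
  "counitX p = poly p 0"

definition antipodeX :: "real poly \<Rightarrow> real poly" where
  "antipodeX p = p \<circ>\<^sub>p [:0, -1:]"

definition tensmapX :: "(real poly \<Rightarrow> real poly) \<Rightarrow> (real poly \<Rightarrow> real poly) \<Rightarrow> RxRx \<Rightarrow> RxRx" where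
  "tensmapX f g u = (\<Sum>p\<in>Poly_Mapping.keys u. ptens (smult (Poly_Mapping.lookup u p) (f (monom 1 (fst p)))) (g (monom 1 (snd p))))"

definition is_1cocycleX :: "(real poly \<Rightarrow> real poly) \<Rightarrow> bool" where
  "is_1cocycleX L \<longleftrightarrow> (\<forall>p. copX (L p) = tensmapX id L (copX p) + ptens (L p) 1)"

definition Lmon :: "real \<Rightarrow> (nat \<Rightarrow> real) \<Rightarrow> nat \<Rightarrow> real poly" where
  "Lmon cm1 c n = monom (- cm1 / real (n + 1)) (n + 1)
     + (\<Sum>i\<in>{1..n}. monom (real (n choose i) * (-1) ^ (n - i) * fact (n - i) * c (n - i)) i)"

definition Lop :: "real \<Rightarrow> (nat \<Rightarrow> real) \<Rightarrow> real poly \<Rightarrow> real poly" where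
  "Lop cm1 c p = (\<Sum>n\<le>degree p. smult (coeff p n) (Lmon cm1 c n))"

primrec phiL_tree :: "(real poly \<Rightarrow> real poly) \<Rightarrow> rtree \<Rightarrow> real poly" where
  "phiL_tree L (Node ws) = L (prod_mset (image_mset (phiL_tree L) ws))"

definition phiL :: "(real poly \<Rightarrow> real poly) \<Rightarrow> forest \<Rightarrow> real poly" where
  "phiL L w = prod_mset (image_mset (phiL_tree L) w)"

definition mellin :: "(real \<Rightarrow> real) \<Rightarrow> complex \<Rightarrow> complex" where
  "mellin f z = integral {0<..} (\<lambda>\<zeta>. complex_of_real (f \<zeta>) * complex_of_real \<zeta> powr (- z))"

primrec nodeprod_tree :: "(complex \<Rightarrow> complex) \<Rightarrow> complex \<Rightarrow> rtree \<Rightarrow> complex" where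
  "nodeprod_tree F z (Node ws) =
     F (z * of_nat (tnodes (Node ws))) * prod_mset (image_mset (nodeprod_tree F z) ws)"

definition phi :: "(complex \<Rightarrow> complex) \<Rightarrow> real \<Rightarrow> forest \<Rightarrow> complex \<Rightarrow> complex" where
  "phi F s w z = complex_of_real s powr (- z * of_nat (fnodes w))
                 * prod_mset (image_mset (nodeprod_tree F z) w)"

definition phiR :: "(complex \<Rightarrow> complex) \<Rightarrow> (forest \<Rightarrow> HR) \<Rightarrow> real \<Rightarrow> real \<Rightarrow> forest \<Rightarrow> complex \<Rightarrow> complex" where
  "phiR F S \<mu> s w z =
     (\<Sum>p\<in>Poly_Mapping.keys (copH w). complex_of_real (Poly_Mapping.lookup (copH w) p)
        * linH (\<lambda>k. phi F \<mu> k z) (S (fst p)) * phi F s (snd p) z)"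

end

theory Submission
  imports Defs
begin

text \<open>
  Since \<open>\<phi>\<^sub>\<mu> \<circ> S\<close> is the convolution inverse \<open>\<psi>\<close> of the character \<open>\<phi>\<^sub>\<mu>\<close>, it is a character, so \<open>\<P>\<close> is
  multiplicative and only \<open>\<P> \<circ> B\<^sub>+ = L \<circ> \<P>\<close> is at stake. With \<open>l = ln (s/\<mu>)\<close> the cocycle property of
  \<open>B\<^sub>+\<close> gives
  \<open>\<phi>\<^bsub>R,s\<^esub>(B\<^sub>+ w) = \<Sum> A\<^sub>i(z) g(m\<^sub>i z)\<close> with \<open>g(x) = F(x) (e\<^bsup>- l x\<^esup> - 1)\<close>, where
  \<open>\<Sum> A\<^sub>i(z) e\<^bsup>- l m\<^sub>i z\<^esup>\<close> tends to the polynomial \<open>p = \<P>(w)\<close> at \<open>l\<close>, for every \<open>l\<close>. As the \<open>A\<^sub>i\<close> have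
  finite pole order, the first sum then tends to \<open>\<Sum>\<^sub>n p\<^sub>n (- 1)\<^sup>n n! g\<^sub>n\<close> for \<open>g = \<Sum> g\<^sub>n x\<^sup>n\<close>, and
  expanding \<open>g\<close> by the Cauchy product turns this into \<open>L p\<close> at \<open>l\<close>.

  The Hopf algebra properties follow from the cocycle property of \<open>L\<close> by induction on forests; that
  property holds because the derivative of \<open>L p\<close> is a constant-coefficient differential operator
  applied to \<open>p\<close>.
\<close>

section \<open>Linear extension\<close>

text \<open>One functional for \<open>HR\<close>, \<open>HRHR\<close> and \<open>RxRx\<close> alike:
  sums over the terms of a coproduct become values of a linear map.\<close>

definition lin :: "('a \<Rightarrow> 'v::real_vector) \<Rightarrow> ('a \<Rightarrow>\<^sub>0 real) \<Rightarrow> 'v" where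
  "lin g u = (\<Sum>k\<in>Poly_Mapping.keys u. Poly_Mapping.lookup u k *\<^sub>R g k)"

text \<open>Coefficients vanish off \<open>keys\<close>, so several arguments can share one index
  set.\<close>

lemma lin_superset:
  assumes "finite A" "Poly_Mapping.keys u \<subseteq> A"
  shows "lin g u = (\<Sum>k\<in>A. Poly_Mapping.lookup u k *\<^sub>R g k)"
  unfolding lin_def
  by (rule sum.mono_neutral_left) (use assms in \<open>auto simp: in_keys_iff\<close>)

lemma lin_zero [simp]: "lin g 0 = 0"
  by (simp add: lin_def)

lemma lin_single [simp]: "lin g (Poly_Mapping.single k c) = c *\<^sub>R g k"
  by (subst lin_superset[of "{k}"]) auto

lemma lin_add: "lin g (u + v) = lin g u + lin g v"
proof -
  let ?A = "Poly_Mapping.keys u \<union> Poly_Mapping.keys v"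
  have "lin g w = (\<Sum>k\<in>?A. Poly_Mapping.lookup w k *\<^sub>R g k)" if "w \<in> {u, v, u + v}" for w
    by (rule lin_superset) (use that Poly_Mapping.keys_add[of u v] in auto)
  then show ?thesis
    by (simp add: lookup_add scaleR_left_distrib sum.distrib)
qed

lemma lin_uminus: "lin g (- u) = - lin g u"
  using lin_add[of g u "- u"] by (simp add: eq_neg_iff_add_eq_0 add.commute)

lemma lin_diff: "lin g (u - v) = lin g u - lin g v"
  using lin_add[of g u "- v"] by (simp add: lin_uminus)

lemma lin_sum: "lin g (\<Sum>i\<in>A. u i) = (\<Sum>i\<in>A. lin g (u i))"
  by (induction A rule: infinite_finite_induct) (auto simp: lin_add)

lemma poly_mapping_eq_sum_single:
  "u = (\<Sum>k\<in>Poly_Mapping.keys u. Poly_Mapping.single k (Poly_Mapping.lookup u k))"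
  by (rule poly_mapping_eqI)
    (auto simp: lookup_sum lookup_single when_def in_keys_iff sum.delta')

lemma lin_compose_sum:
  "lin g (\<Sum>k\<in>Poly_Mapping.keys u. Poly_Mapping.single (h k) (Poly_Mapping.lookup u k)) = lin (\<lambda>k. g (h k)) u"
  by (simp add: lin_sum lin_def[of _ u])

lemma lin_scal: "lin g (scal c u) = c *\<^sub>R lin g u"
proof -
  have "Poly_Mapping.lookup (scal c u) k = c * Poly_Mapping.lookup u k" for k
    unfolding scal_def by (simp add: Poly_Mapping.map.rep_eq when_def)
  moreover from this have "Poly_Mapping.keys (scal c u) \<subseteq> Poly_Mapping.keys u"
    by (auto simp: in_keys_iff)
  ultimately show ?thesis
    by (subst lin_superset[of "Poly_Mapping.keys u"]) (auto simp: lin_def scaleR_sum_right)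
qed

lemma lin_times: "lin g (u * v) = lin (\<lambda>p. lin (\<lambda>q. g (p + q)) v) u"
proof -
  have "lin g (u * v) = lin g ((\<Sum>k\<in>Poly_Mapping.keys u. Poly_Mapping.single k (Poly_Mapping.lookup u k)) *
      (\<Sum>k\<in>Poly_Mapping.keys v. Poly_Mapping.single k (Poly_Mapping.lookup v k)))"
    using poly_mapping_eq_sum_single by metis
  also have "\<dots> = lin (\<lambda>p. lin (\<lambda>q. g (p + q)) v) u"
    by (simp add: sum_product lin_sum mult_single lin_def[of _ u] lin_def[of _ v] scaleR_sum_right)
  finally show ?thesis .
qed

lemma lin_mult_right:
  fixes g :: "'a \<Rightarrow> 'v::real_algebra"
  shows "lin (\<lambda>k. g k * y) u = lin g u * y"
  by (simp add: lin_def sum_distrib_right)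

lemma lin_mult_left:
  fixes g :: "'a \<Rightarrow> 'v::real_algebra"
  shows "lin (\<lambda>k. y * g k) u = y * lin g u"
  by (simp add: lin_def sum_distrib_left)

lemma lin_mult:
  fixes g :: "'a::comm_monoid_add \<Rightarrow> 'v::real_algebra"
  assumes "\<And>a b. g (a + b) = g a * g b"
  shows "lin g (u * v) = lin g u * lin g v"
  by (simp add: lin_times assms lin_mult_left lin_mult_right)

lemma lin_one: "lin g 1 = g 0"
  using lin_single[of g 0 1] by simp

section \<open>Coproduct and convolution on forests\<close>

text \<open>Every forest is a finite product of trees and every tree is a graft, so the unit,
  products and grafting generate all forests. These are the operations on which characters and
  \<open>copH\<close> are computed.\<close>

lemma forest_induct [case_names empty add graft]:
  assumes "Pr {#}" "\<And>a b. Pr a \<Longrightarrow> Pr b \<Longrightarrow> Pr (a + b)" "\<And>w. Pr w \<Longrightarrow> Pr {#Node w#}"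
  shows "Pr (w :: forest)"
proof -
  have forest: "Pr v" if "\<And>t. t \<in># v \<Longrightarrow> Pr {#t#}" for v
    using that
  proof (induction v)
    case (add t v)
    then have "Pr ({#t#} + v)" by (intro assms(2)) auto
    then show ?case by simp
  qed (rule assms(1))
  have "Pr {#t#}" for t
    by (induction t) (blast intro: assms(3) forest)
  then show ?thesis by (rule forest)
qed

lemma copH_add: "copH (a + b) = copH a * copH b"
  by (simp add: copH_def)

lemma lin_copH_empty [simp]: "lin g (copH {#}) = g ({#}, {#})"
  using lin_one[of g] by (simp add: copH_def zero_prod_def)

text \<open>The cocycle property of grafting, in the form seen by a linear functional.\<close>

lemma lin_copH_Node:
  "lin g (copH {#Node w#}) = g ({#Node w#}, {#}) + lin (\<lambda>p. g (fst p, {#Node (snd p)#})) (copH w)"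
  by (simp add: copH_def lin_add id_tensor_Bplus_def lin_compose_sum Bplus_def)

lemma fnodes_add [simp]: "fnodes (a + b) = fnodes a + fnodes b"
  by (simp add: fnodes_def)

lemma fnodes_empty [simp]: "fnodes {#} = 0"
  by (simp add: fnodes_def)

lemma fnodes_Node [simp]: "fnodes {#Node w#} = Suc (fnodes w)"
  by (simp add: fnodes_def)

lemma fnodes_eq_0_iff: "fnodes w = 0 \<longleftrightarrow> w = {#}"
proof -
  have "tnodes t \<noteq> 0" for t by (cases t) auto
  then show ?thesis
    by (metis fnodes_def fnodes_empty image_mset_add_mset sum_mset.insert add_eq_0_iff_both_eq_0 multiset_cases)
qed

text \<open>The coproduct respects the grading by number of nodes: products add degrees, and the
  root grafted onto the right factor accounts for the new node. This makes induction on
  \<open>fnodes\<close> possible.\<close>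

lemma fnodes_copH:
  assumes "p \<in> Poly_Mapping.keys (copH w)"
  shows "fnodes (fst p) + fnodes (snd p) = fnodes w"
  using assms
proof (induction w arbitrary: p rule: forest_induct)
  case empty
  then show ?case by (auto simp: copH_def zero_prod_def split: if_splits)
next
  case (add a b)
  from add.prems obtain q r where "q \<in> Poly_Mapping.keys (copH a)" "r \<in> Poly_Mapping.keys (copH b)" "p = q + r"
    using keys_mult[of "copH a" "copH b"] by (auto simp: copH_add)
  then show ?case using add.IH by fastforce
next
  case (graft w)
  have "p \<in> Poly_Mapping.keys (Poly_Mapping.single ({#Node w#}, {#}) (1::real)) \<union>
     Poly_Mapping.keys (id_tensor_Bplus (copH w))"
    using graft.prems Poly_Mapping.keys_add[of "Poly_Mapping.single ({#Node w#}, {#}) (1::real)" "id_tensor_Bplus (copH w)"]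
    by (auto simp: copH_def)
  then show ?case
  proof
    assume "p \<in> Poly_Mapping.keys (id_tensor_Bplus (copH w))"
    then obtain q where "q \<in> Poly_Mapping.keys (copH w)"
      "p \<in> Poly_Mapping.keys (Poly_Mapping.single (fst q, {#Bplus (snd q)#}) (Poly_Mapping.lookup (copH w) q))"
      unfolding id_tensor_Bplus_def using keys_sum by fast
    then show ?case using graft.IH[of q] by (auto simp: Bplus_def split: if_splits)
  qed (auto split: if_splits)
qed

text \<open>Applying the counit to the right factor of the coproduct gives the identity. The map
  \<open>h\<close> stays arbitrary because the product case applies the hypothesis to translates of
  \<open>h\<close>.\<close>

lemma right_counit:
  "lin (\<lambda>p. if snd p = {#} then h (fst p) else 0) (copH w) = h w"
proof (induction w arbitrary: h rule: forest_induct)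
  case (add a b)
  have "lin (\<lambda>q. if snd (p + q) = {#} then h (fst (p + q)) else 0) (copH b)
      = (if snd p = {#} then h (fst p + b) else 0)" for p
    using add.IH(2)[of "\<lambda>x. h (fst p + x)"] by (cases "snd p = {#}") (auto simp: lin_def cong: if_cong)
  then show ?case
    using add.IH(1)[of "\<lambda>x. h (x + b)"] by (simp add: copH_add lin_times)
next
  case (graft w)
  show ?case by (simp add: lin_copH_Node) (simp add: lin_def)
qed simp

section \<open>Convolution and its inverses\<close>

definition conv :: "(forest \<Rightarrow> 'v::real_algebra_1) \<Rightarrow> (forest \<Rightarrow> 'v) \<Rightarrow> forest \<Rightarrow> 'v" where
  "conv \<alpha> \<beta> w = lin (\<lambda>p. \<alpha> (fst p) * \<beta> (snd p)) (copH w)"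

text \<open>Convolution with \<open>\<beta>\<close> on the right is unitriangular for the node
  grading, hence injective; left inverses are therefore unique.\<close>

lemma conv_eq_0_imp:
  assumes "\<And>w. conv \<alpha> \<beta> w = 0" "\<beta> {#} = 1"
  shows "\<alpha> w = 0"
proof (induction "fnodes w" arbitrary: w rule: less_induct)
  case less
  \<comment> \<open>If the right factor is nonempty, the left one has fewer nodes and
    \<open>\<alpha>\<close> vanishes there by induction.\<close>
  have "\<alpha> (fst p) * \<beta> (snd p) = (if snd p = {#} then \<alpha> (fst p) else 0)"
    if "p \<in> Poly_Mapping.keys (copH w)" for p
    using fnodes_copH[OF that] less[of "fst p"] fnodes_eq_0_iff[of "snd p"] assms(2) by auto
  then have "conv \<alpha> \<beta> w = lin (\<lambda>p. if snd p = {#} then \<alpha> (fst p) else 0) (copH w)"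
    unfolding conv_def lin_def by (intro sum.cong) auto
  then show ?case using assms(1) right_counit[of \<alpha> w] by simp
qed

lemma conv_mult:
  fixes \<alpha> \<beta> :: "forest \<Rightarrow> 'v::{real_algebra_1, comm_ring_1}"
  assumes "\<And>a b. \<alpha> (a + b) = \<alpha> a * \<alpha> b" "\<And>a b. \<beta> (a + b) = \<beta> a * \<beta> b"
  shows "conv \<alpha> \<beta> (a + b) = conv \<alpha> \<beta> a * conv \<alpha> \<beta> b"
  unfolding conv_def copH_add by (rule lin_mult) (simp add: assms mult_ac)

lemma conv_diff:
  "conv (\<lambda>w. \<alpha> w - \<alpha>' w) \<beta> w = conv \<alpha> \<beta> w - conv \<alpha>' \<beta> w"
  by (simp add: conv_def lin_def algebra_simps sum_subtractf)

text \<open>The defect \<open>\<alpha>(a + b) - \<alpha>(a) \<alpha>(b)\<close> is annihilated by convolution with \<open>\<beta>\<close> in both arguments.\<close>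
lemma left_inverse_mult:
  fixes \<alpha> \<beta> :: "forest \<Rightarrow> 'v::{real_algebra_1, comm_ring_1}"
  assumes inv: "\<And>w. conv \<alpha> \<beta> w = of_real (counitH w)"
    and mult: "\<And>a b. \<beta> (a + b) = \<beta> a * \<beta> b" and unit: "\<beta> {#} = 1"
  shows "\<alpha> (a + b) = \<alpha> a * \<alpha> b"
proof -
  define D where "D a b = \<alpha> (a + b) - \<alpha> a * \<alpha> b" for a b
  have "conv (\<lambda>a. conv (D a) \<beta> b) \<beta> a = 0" for a b
  proof -
    have "conv (\<lambda>a. conv (D a) \<beta> b) \<beta> a =
        lin (\<lambda>p. lin (\<lambda>q. D (fst p) (fst q) * \<beta> (snd q) * \<beta> (snd p)) (copH b)) (copH a)"
      by (simp add: conv_def lin_mult_right)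
    also have "\<dots> = lin (\<lambda>p. lin (\<lambda>q. \<alpha> (fst p + fst q) * \<beta> (snd p + snd q)) (copH b)) (copH a)
        - lin (\<lambda>p. lin (\<lambda>q. (\<alpha> (fst p) * \<beta> (snd p)) * (\<alpha> (fst q) * \<beta> (snd q))) (copH b)) (copH a)"
      by (simp add: lin_def D_def mult algebra_simps sum_subtractf scaleR_right_diff_distrib)
    also have "\<dots> = conv \<alpha> \<beta> (a + b) - conv \<alpha> \<beta> a * conv \<alpha> \<beta> b"
      by (simp add: lin_mult_left lin_mult_right conv_def copH_add lin_times)
    also have "\<dots> = 0" by (simp add: inv counitH_def)
    finally show ?thesis .
  qed
  then have "conv (D a) \<beta> b = 0" for a b
    by (rule conv_eq_0_imp) (rule unit)
  then have "D a b = 0" for a b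
    by (rule conv_eq_0_imp) (rule unit)
  then show ?thesis by (simp add: D_def)
qed

section \<open>The operator on polynomials\<close>

lemma smult_sum_right: "smult a (\<Sum>i\<in>A. p i) = (\<Sum>i\<in>A. smult a (p i))"
  by (induction A rule: infinite_finite_induct) (auto simp: smult_add_right)

lemma Lop_eq:
  assumes "degree p \<le> N"
  shows "Lop cm1 c p = (\<Sum>n\<le>N. smult (coeff p n) (Lmon cm1 c n))"
  unfolding Lop_def using assms
  by (intro sum.mono_neutral_left) (auto simp: coeff_eq_0)

lemma Lop_add: "Lop cm1 c (p + q) = Lop cm1 c p + Lop cm1 c q"
proof -
  let ?N = "max (degree p) (degree q)"
  have "Lop cm1 c r = (\<Sum>n\<le>?N. smult (coeff r n) (Lmon cm1 c n))" if "r \<in> {p, q, p + q}" for r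
    by (rule Lop_eq) (use that degree_add_le_max in auto)
  then show ?thesis by (simp add: smult_add_left sum.distrib)
qed

lemma Lop_smult: "Lop cm1 c (smult a p) = smult a (Lop cm1 c p)"
proof -
  have "Lop cm1 c (smult a p) = (\<Sum>n\<le>degree p. smult (a * coeff p n) (Lmon cm1 c n))"
    using Lop_eq[OF degree_smult_le[of a p]] by simp
  then show ?thesis by (simp add: Lop_def smult_sum_right)
qed

lemma Lop_sum: "Lop cm1 c (\<Sum>i\<in>A. p i) = (\<Sum>i\<in>A. Lop cm1 c (p i))"
proof -
  have "Lop cm1 c 0 = 0" by (simp add: Lop_def)
  then show ?thesis
    by (induction A rule: infinite_finite_induct) (auto simp: Lop_add)
qed

text \<open>The sum in \<open>Lmon\<close> starts at \<open>i = 1\<close>, so no constant term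
  occurs. This fixes the constant of integration below and gives compatibility with the
  counits.\<close>

lemma poly_Lop_0: "poly (Lop cm1 c p) 0 = 0"
  by (simp add: Lop_def Lmon_def poly_sum poly_monom)

section \<open>The derivative of the operator and translations\<close>

lemma higher_pderiv_monom_real:
  assumes "k \<le> n"
  shows "(pderiv ^^ k) (monom 1 n :: real poly) = monom (fact n / fact (n - k)) (n - k)"
  using assms
proof (induction k)
  case (Suc k)
  then have "Suc (n - Suc k) = n - k" by simp
  then have "fact (n - k) = real (n - k) * fact (n - Suc k)"
    by (metis fact_Suc of_nat_fact of_nat_mult)
  then have "real (n - k) * (fact n / fact (n - k)) = fact n / fact (n - Suc k)"
    using Suc.prems by (simp del: of_nat_diff)
  then show ?case using Suc by (simp add: pderiv_monom del: of_nat_diff)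
qed simp

text \<open>As \<open>n choose i\<close> times \<open>(n - i)!\<close> is \<open>n! / i!\<close>,
  the summand of degree \<open>i\<close> is a multiple of the derivative of x^n of order
  \<open>k = n - i\<close>. The absent \<open>i = 0\<close> would be killed by the further
  derivative.\<close>

lemma pderiv_Lmon:
  "pderiv (Lmon cm1 c n) = smult (- cm1) (monom 1 n)
     + (\<Sum>k<n. smult ((-1) ^ k * c k) ((pderiv ^^ Suc k) (monom 1 n)))"
proof -
  have "pderiv (monom (real (n choose i) * (-1) ^ (n - i) * fact (n - i) * c (n - i)) i)
      = smult ((-1) ^ (n - i) * c (n - i)) ((pderiv ^^ Suc (n - i)) (monom 1 n))"
    if "i \<in> {1..n}" for i
  proof -
    have i: "n - Suc (n - i) = i - 1" "Suc (n - i) \<le> n" using that by auto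
    have "fact i = real i * fact (i - 1)" using that by (simp add: fact_reduce)
    moreover have "real (n choose i) = fact n / (fact i * fact (n - i))"
      using that by (simp add: binomial_fact)
    ultimately have "real i * (real (n choose i) * fact (n - i)) = fact n / fact (i - 1)"
      using that by (simp add: field_simps)
    then show ?thesis
      unfolding higher_pderiv_monom_real[OF i(2)] i(1)
      by (simp add: pderiv_monom smult_monom ac_simps) (simp add: mult.assoc[symmetric] del: mult.assoc)
  qed
  then have "(\<Sum>i\<in>{1..n}. pderiv (monom (real (n choose i) * (-1) ^ (n - i) * fact (n - i) * c (n - i)) i))
      = (\<Sum>i\<in>{1..n}. smult ((-1) ^ (n - i) * c (n - i)) ((pderiv ^^ Suc (n - i)) (monom 1 n)))"
    by (rule sum.cong[OF refl])
  also have "\<dots> = (\<Sum>k<n. smult ((-1) ^ k * c k) ((pderiv ^^ Suc k) (monom 1 n)))"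
    by (rule sum.reindex_bij_witness[of _ "\<lambda>k. n - k" "\<lambda>i. n - i"]) auto
  finally show ?thesis
    by (simp add: Lmon_def pderiv_add higher_pderiv_sum[of 1, simplified] pderiv_monom smult_monom
        del: funpow.simps)
qed

text \<open>Derivatives beyond the degree vanish, so the range of \<open>k\<close> can be cut at any
  common bound \<open>N\<close>; the operator then no longer depends on the monomial and linearity
  finishes.\<close>

lemma pderiv_Lop:
  assumes "degree p \<le> N"
  shows "pderiv (Lop cm1 c p) = smult (- cm1) p
     + (\<Sum>k<N. smult ((-1) ^ k * c k) ((pderiv ^^ Suc k) p))"
proof -
  have mon: "pderiv (Lmon cm1 c n) = smult (- cm1) (monom 1 n)
     + (\<Sum>k<N. smult ((-1) ^ k * c k) ((pderiv ^^ Suc k) (monom 1 n)))" if "n \<le> N" for n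
    unfolding pderiv_Lmon using that
    by (intro arg_cong2[where f = "(+)"] refl sum.mono_neutral_left)
      (auto intro!: poly_eqI simp: coeff_higher_pderiv simp del: funpow.simps)
  define T where "T q = smult (- cm1) q
     + (\<Sum>k<N. smult ((-1) ^ k * c k) ((pderiv ^^ Suc k) q))" for q
  have T_sum: "T (\<Sum>n\<le>N. smult (a n) (q n)) = (\<Sum>n\<le>N. smult (a n) (T (q n)))" for a q
    unfolding T_def
    by (simp add: higher_pderiv_sum higher_pderiv_smult smult_sum_right smult_add_right smult_diff_right sum.distrib sum_subtractf
        mult_ac sum_negf sum.swap[of _ "{..<N}"] del: funpow.simps)
  have "pderiv (Lop cm1 c p) = (\<Sum>n\<le>N. smult (coeff p n) (T (monom 1 n)))"
    unfolding Lop_eq[OF assms] T_def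
    by (simp add: higher_pderiv_sum[of 1, simplified] pderiv_smult mon del: funpow.simps)
  also have "\<dots> = T (\<Sum>n\<le>N. smult (coeff p n) (monom 1 n))"
    by (rule T_sum[symmetric])
  also have "(\<Sum>n\<le>N. smult (coeff p n) (monom 1 n)) = p"
    using poly_as_sum_of_monoms'[OF assms] by (simp add: smult_monom)
  finally show ?thesis by (simp add: T_def)
qed

lemma higher_pderiv_shift:
  "(pderiv ^^ k) (p \<circ>\<^sub>p [:x, 1:]) = (pderiv ^^ k) p \<circ>\<^sub>p [:x, 1:]" for p :: "real poly"
  by (induction k) (simp_all add: pderiv_pcompose pderiv_pCons)

text \<open>Both sides vanish at \<open>0\<close>, and \<open>pderiv \<circ> Lop cm1 c\<close> is a constant-coefficient differential
  operator, hence commutes with translations.\<close>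
lemma Lop_shift:
  "Lop cm1 c (p \<circ>\<^sub>p [:x, 1:]) = Lop cm1 c p \<circ>\<^sub>p [:x, 1:] - [:poly (Lop cm1 c p) x:]"
proof -
  let ?q = "[:x, 1:]"
  let ?D = "Lop cm1 c (p \<circ>\<^sub>p ?q) - (Lop cm1 c p \<circ>\<^sub>p ?q - [:poly (Lop cm1 c p) x:])"
  \<comment> \<open>Translation preserves the degree, so one truncation order serves
    \<open>p\<close> and its translate.\<close>
  have "pderiv ?D = 0"
    by (simp add: pderiv_diff pderiv_pCons pderiv_pcompose
        pderiv_Lop[of _ "degree p"] degree_pcompose higher_pderiv_shift pcompose_add pcompose_smult
        pcompose_sum pcompose_uminus pcompose_diff del: funpow.simps)
  then obtain a where a: "?D = [:a:]"
    unfolding pderiv_eq_0_iff using degree_0_id by metis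
  have "poly ?D 0 = 0" by (simp add: poly_Lop_0 poly_pcompose)
  then have "?D = 0" unfolding a by simp
  then show ?thesis by simp
qed

section \<open>Bivariate polynomials as functions\<close>

definition ev2 :: "RxRx \<Rightarrow> real \<Rightarrow> real \<Rightarrow> real" where
  "ev2 u x y = lin (\<lambda>p. x ^ fst p * y ^ snd p) u"

text \<open>A real polynomial in two variables is determined by its values: freezing
  \<open>y\<close> forces each coefficient in \<open>x\<close> to vanish, and that coefficient is
  itself a polynomial in \<open>y\<close>.\<close>

lemma ev2_inject:
  assumes "\<And>x y. ev2 u x y = ev2 v x y"
  shows "u = v"
proof -
  define w where "w = u - v"
  have 0: "ev2 w x y = 0" for x y
    using assms by (simp add: w_def ev2_def lin_diff)
  define K where "K = Poly_Mapping.keys w"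
  have "Poly_Mapping.lookup w (i, j) = 0" for i j
  proof (rule ccontr)
    assume nz: "Poly_Mapping.lookup w (i, j) \<noteq> 0"
    \<comment> \<open>\<open>Q y\<close> is the polynomial in \<open>x\<close> for frozen
      \<open>y\<close>; \<open>R\<close> below is its coefficient of x^i as a polynomial in
      \<open>y\<close>.\<close>
    define Q where "Q y = (\<Sum>p\<in>K. monom (Poly_Mapping.lookup w p * y ^ snd p) (fst p))" for y
    define R where "R = (\<Sum>p\<in>K. if fst p = i then monom (Poly_Mapping.lookup w p) (snd p) else 0)"
    have "poly (Q y) x = poly 0 x" for x y
      using 0[of x y] by (simp add: Q_def ev2_def lin_def poly_sum poly_monom K_def mult_ac)
    then have "Q y = 0" for y by (intro poly_ext) auto
    moreover have "coeff (Q y) i = poly R y" for y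
      unfolding Q_def R_def coeff_sum poly_sum by (intro sum.cong) (auto simp: poly_monom)
    ultimately have "poly R y = poly 0 y" for y by (metis coeff_0 poly_0)
    then have "R = 0" by (intro poly_ext) auto
    moreover have "coeff R j = (\<Sum>p\<in>K. if p = (i, j) then Poly_Mapping.lookup w p else 0)"
      unfolding R_def coeff_sum by (intro sum.cong) auto
    ultimately show False using nz by (simp add: K_def in_keys_iff sum.delta)
  qed
  then have "w = 0" by (intro poly_mapping_eqI) auto
  then show ?thesis by (simp add: w_def)
qed

lemma ev2_add: "ev2 (u + v) x y = ev2 u x y + ev2 v x y"
  by (simp add: ev2_def lin_add)

lemma ev2_sum: "ev2 (\<Sum>i\<in>A. u i) x y = (\<Sum>i\<in>A. ev2 (u i) x y)"
  by (simp add: ev2_def lin_sum)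

lemma ev2_ptens: "ev2 (ptens p q) x y = poly p x * poly q y"
  by (simp add: ev2_def ptens_def lin_sum poly_altdef sum_product mult_ac)

lemma lin_copX:
  "lin g (copX p) = (\<Sum>n\<le>degree p. \<Sum>k\<le>n. (coeff p n * real (n choose k)) *\<^sub>R g (k, n - k))"
  by (simp add: copX_def lin_sum)

text \<open>By the binomial theorem the coproduct becomes addition of arguments, so coproduct
  identities turn into identities about translations.\<close>

lemma ev2_copX: "ev2 (copX p) x y = poly p (x + y)"
  by (simp add: ev2_def lin_copX poly_altdef binomial_ring sum_distrib_left mult_ac)

lemma ev2_tensmapX:
  "ev2 (tensmapX id L u) x y = lin (\<lambda>p. x ^ fst p * poly (L (monom 1 (snd p))) y) u"
proof -
  have "ev2 (tensmapX id L u) x y = (\<Sum>p\<in>Poly_Mapping.keys u.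
      ev2 (ptens (smult (Poly_Mapping.lookup u p) (monom 1 (fst p))) (L (monom 1 (snd p)))) x y)"
    by (simp add: tensmapX_def ev2_def lin_sum)
  then show ?thesis by (simp add: ev2_ptens lin_def poly_monom mult_ac)
qed

lemma shift_eq_sum:
  "p \<circ>\<^sub>p [:x, 1:] = (\<Sum>n\<le>degree p. \<Sum>k\<le>n. smult (coeff p n * real (n choose k) * x ^ k) (monom 1 (n - k)))"
  by (rule poly_ext)
    (simp add: poly_pcompose poly_sum poly_monom poly_altdef[of p] binomial_ring sum_distrib_left mult_ac)

text \<open>Read as functions of \<open>x\<close> and \<open>y\<close>, the cocycle equation is the
  translation rule \<open>Lop_shift\<close>.\<close>

lemma is_1cocycleX_Lop: "is_1cocycleX (Lop cm1 c)"
  unfolding is_1cocycleX_def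
proof (intro allI ev2_inject)
  fix p x y
  have "ev2 (tensmapX id (Lop cm1 c) (copX p)) x y = poly (Lop cm1 c (p \<circ>\<^sub>p [:x, 1:])) y"
    by (simp add: ev2_tensmapX lin_copX shift_eq_sum Lop_sum Lop_smult poly_sum mult_ac)
  then show "ev2 (copX (Lop cm1 c p)) x y =
      ev2 (tensmapX id (Lop cm1 c) (copX p) + ptens (Lop cm1 c p) 1) x y"
    by (simp add: ev2_copX ev2_add ev2_ptens Lop_shift poly_pcompose add.commute)
qed

section \<open>Regularized sums of exponentials\<close>

text \<open>The series converges at small positive reals, hence the series with x^N divided out
  converges on a full disc. Its sum \<open>R\<close> has a limit at \<open>0\<close>, and
  \<open>g\<close> is x^N times \<open>R\<close> on \<open>H\<close>.\<close>

lemma powser_tail_bigo: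
  fixes a :: "nat \<Rightarrow> complex"
  assumes "r > 0" and sums: "\<And>x. x \<in> H \<Longrightarrow> norm x < r \<Longrightarrow> (\<lambda>n. a n * x ^ n) sums g x"
    and H: "\<And>t. t > 0 \<Longrightarrow> complex_of_real t \<in> H"
    and low: "\<And>n. n < N \<Longrightarrow> a n = 0"
  shows "g \<in> O[at 0 within H](\<lambda>x. x ^ N)"
proof -
  define s where "s = r / 2"
  have s: "0 < s" "s < r" using \<open>r > 0\<close> by (auto simp: s_def)
  have "summable (\<lambda>n. a n * of_real s ^ n)"
    using sums[of "of_real s"] H[of s] s by (auto simp: sums_iff)
  then have "summable (\<lambda>n. a (n + N) * of_real s ^ (n + N))"
    by (rule summable_ignore_initial_segment)
  then have "summable (\<lambda>n. of_real s ^ N * (a (n + N) * of_real s ^ n))"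
    by (simp add: power_add mult_ac)
  then have "summable (\<lambda>n. a (n + N) * of_real s ^ n)"
    by (rule summable_mult_D) (use s in auto)
  then have "summable (\<lambda>n. a (n + N) * x ^ n)" if "norm x < s" for x
    by (rule powser_inside) (use that s in auto)
  then obtain R where R: "\<And>x. norm x < s \<Longrightarrow> (\<lambda>n. a (n + N) * x ^ n) sums R x"
    unfolding summable_def by metis
  have "(R \<longlongrightarrow> a (0 + N)) (at 0)"
    by (rule powser_limit_0[OF s(1)]) (rule R)
  then have "(R \<longlongrightarrow> a (0 + N)) (at 0 within H)"
    by (rule tendsto_within_subset) auto
  then have bounded: "R \<in> O[at 0 within H](\<lambda>_. 1)"
    by (intro bigoI_tendsto) auto
  have eq: "g x = R x * x ^ N" if "x \<in> H" "norm x < s" for x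
  proof -
    have "(\<lambda>n. a (n + N) * x ^ n * x ^ N) sums (R x * x ^ N)"
      by (rule sums_mult2) (rule R, fact)
    then have "(\<lambda>n. a (n + N) * x ^ (n + N)) sums (R x * x ^ N)"
      by (simp add: power_add mult_ac)
    moreover have "(\<lambda>n. a (n + N) * x ^ (n + N)) sums (g x - (\<Sum>i<N. a i * x ^ i))"
      using sums[of x] that s by (intro sums_split_initial_segment) auto
    ultimately have "R x * x ^ N = g x - (\<Sum>i<N. a i * x ^ i)"
      by (rule sums_unique2)
    then show ?thesis using low by simp
  qed
  have "eventually (\<lambda>x. x \<in> H \<and> norm x < s) (at 0 within H)"
    using s(1) by (auto simp: eventually_at intro!: exI[of _ s])
  then have "eventually (\<lambda>x. g x = R x * x ^ N) (at 0 within H)"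
    by eventually_elim (use eq in auto)
  moreover have "(\<lambda>x. R x * x ^ N) \<in> O[at 0 within H](\<lambda>x. 1 * x ^ N)"
    by (intro landau_o.big.mult bounded) auto
  ultimately show ?thesis by (simp add: landau_o.big.in_cong)
qed

text \<open>Invertibility of the Vandermonde matrix of the nodes \<open>0, \<dots>, N\<close>, via Lagrange interpolation.\<close>
lemma exists_prescribed_moments:
  fixes t :: "nat \<Rightarrow> complex"
  shows "\<exists>a. \<forall>k\<le>N. (\<Sum>j\<le>N. a j * of_nat j ^ k) = t k"
proof -
  define l :: "nat \<Rightarrow> complex poly" where
    "l j = (\<Prod>i\<in>{..N} - {j}. smult (1 / (of_nat j - of_nat i)) [:- of_nat i, 1:])" for j
  have deg: "degree (l j) \<le> N" if "j \<le> N" for j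
  proof -
    have "degree (l j) \<le> (\<Sum>i\<in>{..N} - {j}. degree (smult (1 / (of_nat j - of_nat i)) [:- of_nat i, 1 :: complex:]))"
      unfolding l_def by (rule degree_prod_sum_le[unfolded o_def]) simp
    also have "\<dots> \<le> (\<Sum>i\<in>{..N} - {j}. 1)"
      by (intro sum_mono) (auto intro: order_trans[OF degree_smult_le])
    finally show ?thesis using that by simp
  qed
  have val: "poly (l j) (of_nat i) = (if i = j then 1 else 0)" if "i \<le> N" for i j
    using that by (auto simp: l_def poly_prod intro!: prod.neutral simp flip: diff_divide_distrib)
  \<comment> \<open>Both sides have degree at most \<open>N\<close> and agree at
    \<open>N + 1\<close> nodes.\<close>
  have interp: "(\<Sum>j\<le>N. smult (of_nat j ^ k) (l j)) = monom 1 k" if "k \<le> N" for k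
  proof (rule poly_eqI_degree)
    fix x :: complex assume "x \<in> of_nat ` {..N}"
    then show "poly (\<Sum>j\<le>N. smult (of_nat j ^ k) (l j)) x = poly (monom 1 k) x"
      by (auto simp: poly_sum poly_monom val sum.delta if_distrib cong: if_cong)
  next
    have card: "card (of_nat ` {..N} :: complex set) = Suc N"
      by (subst card_image) (auto simp: inj_on_def)
    have "degree (\<Sum>j\<le>N. smult (of_nat j ^ k) (l j)) \<le> N"
      by (intro degree_sum_le) (auto intro: deg order_trans[OF degree_smult_le])
    then show "degree (\<Sum>j\<le>N. smult (of_nat j ^ k) (l j)) < card (of_nat ` {..N} :: complex set)"
      by (simp add: card)
    show "degree (monom 1 k :: complex poly) < card (of_nat ` {..N} :: complex set)"
      using that degree_monom_le[of "1::complex" k] by (simp add: card)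
  qed
  \<comment> \<open>The weight at \<open>j\<close> is the functional sending x^i to
    \<open>t i\<close>, applied to the Lagrange polynomial \<open>l j\<close>; applied to
    \<open>interp\<close> it returns \<open>t k\<close>.\<close>
  have "(\<Sum>j\<le>N. (\<Sum>i\<le>N. t i * coeff (l j) i) * of_nat j ^ k) = t k" if "k \<le> N" for k
  proof -
    have "(\<Sum>j\<le>N. (\<Sum>i\<le>N. t i * coeff (l j) i) * of_nat j ^ k)
        = (\<Sum>i\<le>N. t i * coeff (\<Sum>j\<le>N. smult (of_nat j ^ k) (l j)) i)"
      by (simp add: coeff_sum sum_distrib_left sum_distrib_right mult_ac) (rule sum.swap)
    then show ?thesis using that by (simp add: interp if_distrib sum.delta cong: if_cong)
  qed
  then show ?thesis by (intro exI allI impI)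
qed

text \<open>Near \<open>0\<close> a larger pole order is a weaker bound, so the maximum of finitely
  many orders works, raised to at least \<open>M\<close>.\<close>

lemma uniform_pole_order:
  assumes "finite K" "\<And>i. i \<in> K \<Longrightarrow> \<exists>N. A i \<in> O[at (0::complex) within H](\<lambda>z. 1 / z ^ N)"
  shows "\<exists>N\<ge>M. \<forall>i\<in>K. A i \<in> O[at 0 within H](\<lambda>z. 1 / z ^ N)"
proof -
  have mono: "(\<lambda>z. 1 / z ^ m) \<in> O[at (0::complex) within H](\<lambda>z. 1 / z ^ n)" if "m \<le> n" for m n
  proof (rule bigoI[where c = 1])
    have "eventually (\<lambda>z. z \<noteq> 0 \<and> norm z < 1) (at (0::complex) within H)"
      by (auto simp: eventually_at intro!: exI[of _ 1])
    then show "eventually (\<lambda>z. norm (1 / z ^ m) \<le> 1 * norm (1 / z ^ n)) (at (0::complex) within H)"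
    proof eventually_elim
      case (elim z)
      then have "norm z ^ n \<le> norm z ^ m" by (intro power_decreasing that) auto
      then show ?case using elim by (simp add: norm_divide norm_power frac_le)
    qed
  qed
  obtain n where n: "\<And>i. i \<in> K \<Longrightarrow> A i \<in> O[at 0 within H](\<lambda>z. 1 / z ^ n i)"
    using assms(2) by metis
  let ?N = "Max (insert M (n ` K))"
  have "A i \<in> O[at 0 within H](\<lambda>z. 1 / z ^ ?N)" if "i \<in> K" for i
    by (rule landau_o.big.trans[OF n[OF that] mono]) (use that assms(1) in auto)
  then show ?thesis using assms(1) by (intro exI[of _ ?N]) auto
qed

lemma exp_powser:
  fixes a x :: complex
  shows "(\<lambda>n. (a ^ n / fact n) * x ^ n) sums exp (a * x)"
  using exp_converges[of "a * x"] by (simp add: power_mult_distrib scaleR_conv_of_real field_simps)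

lemma filterlim_mult_of_nat_at_0:
  assumes "n > (0::nat)"
  shows "filterlim (\<lambda>z. z * of_nat n) (at 0 within {z. 0 < Re z}) (at 0 within {z. 0 < Re z})"
proof -
  have "((\<lambda>z. z * of_nat n) \<longlongrightarrow> 0 * of_nat n) (at 0 within {z. 0 < Re z})" by (intro tendsto_intros)
  moreover have "eventually (\<lambda>z. z * of_nat n \<in> {z. 0 < Re z} \<and> z * of_nat n \<noteq> 0) (at 0 within {z. 0 < Re z})"
    using assms by (auto simp: eventually_at intro!: exI[of _ 1])
  ultimately show ?thesis by (simp add: filterlim_at)
qed

text \<open>The span of the functions \<open>x \<mapsto> exp (- j x)\<close> contains functions agreeing with \<open>g\<close> to any
  prescribed order at \<open>0\<close>, which reduces the claim to the hypothesis at \<open>l = 0, \<dots>, N\<close>.\<close>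
lemma tendsto_sum_powser:
  fixes A :: "'i \<Rightarrow> complex \<Rightarrow> complex" and p :: "real poly"
  defines "H \<equiv> {z. 0 < Re z}"
  assumes "finite K" and pole: "\<And>i. i \<in> K \<Longrightarrow> \<exists>N. A i \<in> O[at 0 within H](\<lambda>z. 1 / z ^ N)"
    and m: "\<And>i. i \<in> K \<Longrightarrow> m i > (0::nat)"
    and lim: "\<And>l::real. ((\<lambda>z. \<Sum>i\<in>K. A i z * exp (- of_real l * (z * of_nat (m i))))
          \<longlongrightarrow> of_real (poly p l)) (at 0 within H)"
    and "r > 0" and g: "\<And>x. x \<in> H \<Longrightarrow> norm x < r \<Longrightarrow> (\<lambda>n. a n * x ^ n) sums g x"
  shows "((\<lambda>z. \<Sum>i\<in>K. A i z * g (z * of_nat (m i)))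
      \<longlongrightarrow> (\<Sum>n\<le>degree p. of_real (coeff p n) * ((-1) ^ n * fact n * a n))) (at 0 within H)"
proof -
  let ?F = "at (0::complex) within H"
  \<comment> \<open>\<open>N\<close> bounds all pole orders and also the degree of \<open>p\<close>,
    so that every coefficient of \<open>p\<close> meets a prescribed moment.\<close>
  obtain N where N: "N \<ge> degree p" "\<And>i. i \<in> K \<Longrightarrow> A i \<in> O[?F](\<lambda>z. 1 / z ^ N)"
    using uniform_pole_order[of K A H "degree p", OF \<open>finite K\<close> pole] by blast
  \<comment> \<open>The sign and factorial cancel those in the series of \<open>exp (- j x)\<close>,
    so \<open>e\<close> below has the coefficients \<open>a k\<close> up to order
    \<open>N\<close>.\<close>
  obtain b where b: "\<And>k. k \<le> N \<Longrightarrow> (\<Sum>j\<le>N. b j * of_nat j ^ k) = (-1) ^ k * fact k * a k"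
    using exists_prescribed_moments[where t = "\<lambda>k. (-1) ^ k * fact k * a k"] by blast
  define e where "e x = (\<Sum>j\<le>N. b j * exp (- of_nat j * x))" for x :: complex
  have e_sums: "(\<lambda>n. (\<Sum>j\<le>N. b j * ((- of_nat j) ^ n / fact n)) * x ^ n) sums e x" for x
    unfolding e_def sum_distrib_right mult.assoc
    by (intro sums_sum sums_mult exp_powser[unfolded mult.assoc])
  have low: "a n - (\<Sum>j\<le>N. b j * ((- of_nat j) ^ n / fact n)) = 0" if "n < Suc N" for n
  proof -
    have "(\<Sum>j\<le>N. b j * ((- of_nat j) ^ n / fact n)) = (-1) ^ n / fact n * (\<Sum>j\<le>N. b j * of_nat j ^ n)"
      unfolding sum_distrib_left by (intro sum.cong) (auto simp: power_minus[of "of_nat _"])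
    also have "\<dots> = a n" using b[of n] that by (simp add: flip: power_mult_distrib)
    finally show ?thesis by simp
  qed
  have "(\<lambda>x. g x - e x) \<in> O[?F](\<lambda>x. x ^ Suc N)"
  proof (rule powser_tail_bigo[OF \<open>r > 0\<close> _ _ low])
    show "(\<lambda>n. (a n - (\<Sum>j\<le>N. b j * ((- of_nat j) ^ n / fact n))) * x ^ n) sums (g x - e x)"
      if "x \<in> H" "norm x < r" for x
      using sums_diff[OF g[OF that] e_sums[of x]] by (simp add: algebra_simps)
  qed (auto simp: H_def)
  then have "(\<lambda>z. g (z * of_nat n) - e (z * of_nat n)) \<in> O[?F](\<lambda>z. (z * of_nat n) ^ Suc N)"
    if "n > 0" for n :: nat
    using filterlim_mult_of_nat_at_0[OF that] unfolding H_def by (rule landau_o.big.compose)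
  then have diff: "(\<lambda>z. g (z * of_nat n) - e (z * of_nat n)) \<in> O[?F](\<lambda>z. z ^ Suc N)"
    if "n > 0" for n :: nat
    using that by (simp add: power_mult_distrib del: power_Suc)
  have "((\<lambda>z. A i z * (g (z * of_nat (m i)) - e (z * of_nat (m i)))) \<longlongrightarrow> 0) ?F" if "i \<in> K" for i
  proof -
    \<comment> \<open>A pole of order at most \<open>N\<close> meets a zero of order at least
      \<open>N + 1\<close>; a factor \<open>z\<close> remains.\<close>
    have "(\<lambda>z. A i z * (g (z * of_nat (m i)) - e (z * of_nat (m i)))) \<in> O[?F](\<lambda>z. 1 / z ^ N * z ^ Suc N)"
      by (intro landau_o.big.mult N(2) diff m that)
    also have "(\<lambda>z. 1 / z ^ N * z ^ Suc N) \<in> \<Theta>[?F](\<lambda>z. z)"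
      by (intro bigthetaI_cong) (auto simp: eventually_at intro!: exI[of _ 1])
    finally have "(\<lambda>z. A i z * (g (z * of_nat (m i)) - e (z * of_nat (m i)))) \<in> O[?F](\<lambda>z. z)" .
    also have "(\<lambda>z::complex. z) \<in> o[?F](\<lambda>_. 1)"
      by (intro smalloI_tendsto) (auto intro: tendsto_eq_intros)
    finally show ?thesis by (auto dest: smalloD_tendsto)
  qed
  then have "((\<lambda>z. \<Sum>i\<in>K. A i z * (g (z * of_nat (m i)) - e (z * of_nat (m i)))) \<longlongrightarrow> 0) ?F"
    by (rule tendsto_null_sum)
  moreover have "((\<lambda>z. \<Sum>i\<in>K. A i z * e (z * of_nat (m i)))
      \<longlongrightarrow> (\<Sum>n\<le>degree p. of_real (coeff p n) * ((-1) ^ n * fact n * a n))) ?F"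
  proof -
    \<comment> \<open>The hypothesis at \<open>l = j\<close>; summing the powers of \<open>j\<close>
      against \<open>b\<close> then produces the moments.\<close>
    have "((\<lambda>z. \<Sum>j\<le>N. b j * (\<Sum>i\<in>K. A i z * exp (- of_real (real j) * (z * of_nat (m i)))))
        \<longlongrightarrow> (\<Sum>j\<le>N. b j * of_real (poly p (real j)))) ?F"
      by (intro tendsto_sum tendsto_mult_left lim)
    moreover have "(\<Sum>j\<le>N. b j * (\<Sum>i\<in>K. A i z * exp (- of_real (real j) * (z * of_nat (m i)))))
        = (\<Sum>i\<in>K. A i z * e (z * of_nat (m i)))" for z
      unfolding e_def sum_distrib_left by (subst sum.swap) (simp add: mult_ac)
    moreover have "(\<Sum>j\<le>N. b j * of_real (poly p (real j)))
        = (\<Sum>n\<le>degree p. of_real (coeff p n) * (\<Sum>j\<le>N. b j * of_nat j ^ n))"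
      unfolding poly_altdef of_real_sum sum_distrib_left
      by (subst sum.swap) (simp add: mult_ac)
    moreover have "\<dots> = (\<Sum>n\<le>degree p. of_real (coeff p n) * ((-1) ^ n * fact n * a n))"
      using N(1) by (intro sum.cong refl arg_cong2[where f = "(*)"] b) auto
    ultimately show ?thesis by (simp only:)
  qed
  ultimately have "((\<lambda>z. (\<Sum>i\<in>K. A i z * (g (z * of_nat (m i)) - e (z * of_nat (m i))))
      + (\<Sum>i\<in>K. A i z * e (z * of_nat (m i))))
      \<longlongrightarrow> 0 + (\<Sum>n\<le>degree p. of_real (coeff p n) * ((-1) ^ n * fact n * a n))) ?F"
    by (rule tendsto_add)
  then show ?thesis by (simp add: sum.distrib[symmetric] distrib_left[symmetric])
qed

section \<open>Functions of finite pole order\<close>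

abbreviation (input) half_nhds_0 :: "complex filter" where
  "half_nhds_0 \<equiv> at 0 within {z. 0 < Re z}"

lemma half_nhds_0_neq_bot: "half_nhds_0 \<noteq> bot"
proof -
  have "(0::complex) islimpt {z. 0 < Re z}"
  proof (rule islimptI)
    fix T :: "complex set" assume "0 \<in> T" "open T"
    then obtain e where e: "e > 0" "ball 0 e \<subseteq> T" by (meson openE)
    then have "complex_of_real (e / 2) \<in> T" by (intro subsetD[OF e(2)]) auto
    then show "\<exists>y\<in>{z. 0 < Re z}. y \<in> T \<and> y \<noteq> 0"
      using e(1) by (intro bexI[of _ "complex_of_real (e / 2)"]) auto
  qed
  then show ?thesis by (simp add: trivial_limit_within)
qed

text \<open>A growth bound in the half plane stands in for meromorphy at \<open>0\<close>, since
  only the part of a neighbourhood with positive real part is considered.\<close>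

definition fin_pole :: "(complex \<Rightarrow> complex) \<Rightarrow> bool" where
  "fin_pole g \<longleftrightarrow> (\<exists>N. g \<in> O[half_nhds_0](\<lambda>z. 1 / z ^ N))"

lemma fin_pole_tendsto:
  assumes "(g \<longlongrightarrow> c) half_nhds_0"
  shows "fin_pole g"
  unfolding fin_pole_def using assms by (intro exI[of _ 0] bigoI_tendsto) auto

lemma fin_pole_mult:
  assumes "fin_pole g" "fin_pole h"
  shows "fin_pole (\<lambda>z. g z * h z)"
proof -
  obtain m n where "g \<in> O[half_nhds_0](\<lambda>z. 1 / z ^ m)" "h \<in> O[half_nhds_0](\<lambda>z. 1 / z ^ n)"
    using assms by (auto simp: fin_pole_def)
  then have "(\<lambda>z. g z * h z) \<in> O[half_nhds_0](\<lambda>z. 1 / z ^ m * (1 / z ^ n))"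
    by (rule landau_o.big.mult)
  then show ?thesis unfolding fin_pole_def by (intro exI[of _ "m + n"]) (simp add: power_add)
qed

lemma fin_pole_sum:
  assumes "finite K" "\<And>i. i \<in> K \<Longrightarrow> fin_pole (g i)"
  shows "fin_pole (\<lambda>z. \<Sum>i\<in>K. g i z)"
proof -
  obtain N where "\<And>i. i \<in> K \<Longrightarrow> g i \<in> O[half_nhds_0](\<lambda>z. 1 / z ^ N)"
    using uniform_pole_order[of K g "{z. 0 < Re z}" 0, OF assms(1)] assms(2)
    unfolding fin_pole_def by blast
  then show ?thesis unfolding fin_pole_def by (intro exI[of _ N] big_sum_in_bigo)
qed

lemma fin_pole_scale:
  assumes "fin_pole g" "n > (0::nat)"
  shows "fin_pole (\<lambda>z. g (z * of_nat n))"
proof -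
  obtain N where "g \<in> O[half_nhds_0](\<lambda>z. 1 / z ^ N)"
    using assms(1) by (auto simp: fin_pole_def)
  then have "(\<lambda>z. g (z * of_nat n)) \<in> O[half_nhds_0](\<lambda>z. 1 / (z * of_nat n) ^ N)"
    using filterlim_mult_of_nat_at_0[OF assms(2)] by (rule landau_o.big.compose)
  also have "(\<lambda>z. 1 / (z * of_nat n) ^ N) \<in> O[half_nhds_0](\<lambda>z. 1 / z ^ N)"
    using assms(2) by (intro bigoI[where c = "1 / real n ^ N"])
      (simp add: norm_divide norm_mult norm_power power_mult_distrib mult.commute)
  finally show ?thesis unfolding fin_pole_def by blast
qed

section \<open>Regularized rules\<close>

lemma phi_empty [simp]: "s > 0 \<Longrightarrow> phi F s {#} z = 1"
  by (simp add: phi_def)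

lemma phi_add: "phi F s (a + b) z = phi F s a z * phi F s b z"
  unfolding phi_def fnodes_add of_nat_add distrib_left powr_add by simp

lemma phi_Node:
  "phi F s {#Node w#} z = of_real s powr (- z) * F (z * of_nat (Suc (fnodes w))) * phi F s w z"
proof -
  have "- z * of_nat (Suc n) = - z + - z * of_nat n" for n by (simp add: algebra_simps)
  then have "of_real s powr (- z * of_nat (Suc n)) = of_real s powr (- z) * of_real s powr (- z * of_nat n)" for n
    by (metis powr_add)
  then show ?thesis
    by (simp add: phi_def fnodes_def[of w, symmetric] del: of_nat_Suc)
qed

text \<open>With \<open>s = \<mu> * exp l\<close>, changing the scale costs one exponential governed
  by the node grading.\<close>

lemma phi_scale:
  assumes "\<mu> > 0"
  shows "phi F (\<mu> * exp l) w z = phi F \<mu> w z * exp (- of_real l * (z * of_nat (fnodes w)))"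
proof -
  have "Ln (complex_of_real (\<mu> * exp l)) = of_real (ln \<mu>) + of_real l"
    using assms by (simp add: Ln_of_real ln_mult del: of_real_mult)
  then have "of_real (\<mu> * exp l) powr (- z * of_nat (fnodes w))
      = of_real \<mu> powr (- z * of_nat (fnodes w)) * exp (- of_real l * (z * of_nat (fnodes w)))"
    using assms by (simp add: powr_def Ln_of_real exp_add[symmetric] algebra_simps)
  then show ?thesis by (simp add: phi_def)
qed

lemma linH_eq_lin: "linH g h = lin g h"
  by (simp add: linH_def lin_def)

lemma phiR_eq_conv:
  "phiR F S \<mu> s w z = conv (\<lambda>k. lin (\<lambda>k. phi F \<mu> k z) (S k)) (\<lambda>k. phi F s k z) w"
  by (simp add: phiR_def conv_def lin_def linH_eq_lin scaleR_conv_of_real mult.assoc)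

text \<open>A character applied to the left antipode identity turns products in \<open>HR\<close>
  into products of values.\<close>

lemma antipode_left_inverse:
  fixes \<phi> :: "forest \<Rightarrow> 'v::real_algebra_1"
  assumes "is_antipodeH S" "\<And>a b. \<phi> (a + b) = \<phi> a * \<phi> b" "\<phi> {#} = 1"
  shows "conv (\<lambda>k. lin \<phi> (S k)) \<phi> w = of_real (counitH w)"
proof -
  have "lin \<phi> (\<Sum>p\<in>Poly_Mapping.keys (copH w). scal (Poly_Mapping.lookup (copH w) p) (S (fst p) * bas (snd p)))
      = lin \<phi> (scal (counitH w) 1)"
    using assms(1) by (simp add: is_antipodeH_def)
  then show ?thesis
    by (simp add: lin_sum lin_scal lin_mult assms(2,3) lin_one bas_def conv_def of_real_def)
      (simp add: lin_def[of _ "copH w"])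
qed

lemma fin_pole_phi:
  assumes "\<mu> > 0" "fin_pole F"
  shows "fin_pole (phi F \<mu> w)"
proof (induction w rule: forest_induct)
  case empty
  then show ?case using assms(1) by (intro fin_pole_tendsto[of _ 1]) (simp add: phi_def)
next
  case (add a b)
  then show ?case using fin_pole_mult by (simp add: phi_add[abs_def])
next
  case (graft w)
  have "((\<lambda>z. of_real \<mu> powr (- z)) \<longlongrightarrow> of_real \<mu> powr (- 0)) half_nhds_0"
    using assms(1) by (intro tendsto_intros) auto
  then have "fin_pole (\<lambda>z. of_real \<mu> powr (- z))" by (rule fin_pole_tendsto)
  then show ?case
    unfolding phi_Node[abs_def] by (intro fin_pole_mult fin_pole_scale graft assms) auto
qed

section \<open>Laurent coefficients and the operator\<close>

text \<open>The zero of \<open>exp (- l z) - 1\<close> at \<open>0\<close> cancels the simple pole: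
  the polar part shifts the exponential series by one index, the regular part contributes a Cauchy
  product.\<close>

lemma laurent_times_exp_minus_1_sums:
  fixes F :: "complex \<Rightarrow> complex" and l :: real
  defines "E \<equiv> \<lambda>i. if i = 0 then 0 else (- complex_of_real l) ^ i / fact i"
  assumes F: "\<And>z. 0 < Re z \<Longrightarrow> norm z < r \<Longrightarrow> (\<lambda>n. c n * z ^ n) sums (F z - c0 / z)"
    and z: "0 < Re z" "norm z < r"
  shows "(\<lambda>n. (c0 * E (Suc n) + (\<Sum>i\<le>n. E i * c (n - i))) * z ^ n) sums (F z * (exp (- of_real l * z) - 1))"
proof -
  \<comment> \<open>A radius strictly between \<open>norm z\<close> and \<open>r\<close>:
    convergence at \<open>t\<close> gives absolute convergence at \<open>z\<close>.\<close>
  define t where "t = (norm z + r) / 2"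
  have "norm z \<ge> 0" by simp
  then have t: "norm z < t" "t < r" "t > 0" using z by (auto simp: t_def simp del: norm_ge_zero)
  have z0: "z \<noteq> 0" using z by auto
  have "(\<lambda>n. (if n = 0 then (- complex_of_real l) ^ 0 / fact 0 * z ^ 0 else 0)) sums 1"
    using sums_single[of 0 "\<lambda>n. (- complex_of_real l) ^ 0 / fact 0 * z ^ 0"] by simp
  from sums_diff[OF exp_powser[of "- of_real l" z] this]
  have E: "(\<lambda>n. E n * z ^ n) sums (exp (- of_real l * z) - 1)"
    by (rule sums_cong[THEN iffD1, rotated]) (auto simp: E_def)
  have "summable (\<lambda>n. norm ((- complex_of_real l * z) ^ n /\<^sub>R fact n))"
    by (rule summable_norm_exp)
  then have En: "summable (\<lambda>n. norm (E n * z ^ n))"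
    by (rule summable_comparison_test'[where N = 0])
      (auto simp: E_def norm_mult norm_divide norm_power power_mult_distrib field_simps)
  have "summable (\<lambda>n. c n * of_real t ^ n)"
    using F[of "of_real t"] t by (auto simp: sums_iff)
  then have cn: "summable (\<lambda>n. norm (c n * z ^ n))"
    by (rule powser_insidea) (use t in auto)
  have "(\<lambda>n. \<Sum>i\<le>n. (E i * z ^ i) * (c (n - i) * z ^ (n - i))) sums ((exp (- of_real l * z) - 1) * (F z - c0 / z))"
    using Cauchy_product_sums[OF En cn] E F[OF z] by (simp add: sums_iff)
  moreover have "(\<Sum>i\<le>n. (E i * z ^ i) * (c (n - i) * z ^ (n - i))) = (\<Sum>i\<le>n. E i * c (n - i)) * z ^ n" for n
    unfolding sum_distrib_right by (intro sum.cong) (auto simp: power_add[symmetric] mult_ac)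
  ultimately have reg: "(\<lambda>n. (\<Sum>i\<le>n. E i * c (n - i)) * z ^ n) sums ((exp (- of_real l * z) - 1) * (F z - c0 / z))"
    by simp
  have "(\<lambda>n. E (Suc n) * z ^ Suc n) sums (exp (- of_real l * z) - 1)"
    using E by (subst sums_Suc_iff) (simp add: E_def)
  then have "(\<lambda>n. (c0 / z) * (E (Suc n) * z ^ Suc n)) sums ((c0 / z) * (exp (- of_real l * z) - 1))"
    by (rule sums_mult)
  then have "(\<lambda>n. c0 * E (Suc n) * z ^ n) sums ((c0 / z) * (exp (- of_real l * z) - 1))"
    using z0 by (simp add: mult_ac)
  from sums_add[OF this reg] show ?thesis
    by (simp add: algebra_simps)
qed

text \<open>This recognizes the limit as the operator: the sign turns powers of \<open>- l\<close>
  into powers of \<open>l\<close>, and \<open>n! / i!\<close> is the binomial coefficient times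
  \<open>(n - i)!\<close>. The value \<open>e 0 = 0\<close> matches the sum in \<open>Lmon\<close>
  starting at \<open>1\<close>.\<close>

lemma poly_Lmon_eq_cauchy_coeff:
  fixes l cm1 :: real and c :: "nat \<Rightarrow> real"
  defines "e \<equiv> \<lambda>i. if i = 0 then 0 else (- l) ^ i / fact i"
  shows "poly (Lmon cm1 c n) l = (-1) ^ n * fact n * (cm1 * e (Suc n) + (\<Sum>i\<le>n. e i * c (n - i)))"
proof -
  have sign: "(-1) ^ k * (- l) ^ k = l ^ k" for k
    by (simp flip: power_mult_distrib)
  have "(-1) ^ n * fact n * (cm1 * e (Suc n)) = fact n * cm1 * ((-1) ^ n * (- l) ^ n) * (- l) / fact (Suc n)"
    by (simp add: e_def del: fact_Suc)
  also have "\<dots> = - cm1 / real (n + 1) * l ^ (n + 1)"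
    unfolding sign by (simp add: divide_simps del: of_nat_Suc)
  finally have pole: "(-1) ^ n * fact n * (cm1 * e (Suc n)) = - cm1 / real (n + 1) * l ^ (n + 1)" .
  have "(-1) ^ n * fact n * (e i * c (n - i))
      = real (n choose i) * (-1) ^ (n - i) * fact (n - i) * c (n - i) * l ^ i" if "i \<in> {1..n}" for i
  proof -
    have "(-1::real) ^ n = (-1) ^ (n - i) * (-1) ^ i"
      using that by (simp flip: power_add)
    then have "(-1) ^ n * fact n * (e i * c (n - i))
        = (fact n / fact i) * (-1) ^ (n - i) * ((-1) ^ i * (- l) ^ i) * c (n - i)"
      using that by (simp add: e_def)
    also have "fact n / fact i = real (n choose i) * fact (n - i)"
      using that by (simp add: binomial_fact)
    finally show ?thesis unfolding sign by (simp add: mult_ac)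
  qed
  then have "(\<Sum>i\<in>{1..n}. (-1) ^ n * fact n * (e i * c (n - i)))
      = (\<Sum>i\<in>{1..n}. real (n choose i) * (-1) ^ (n - i) * fact (n - i) * c (n - i) * l ^ i)"
    by (rule sum.cong[OF refl])
  moreover have "(\<Sum>i\<le>n. (-1) ^ n * fact n * (e i * c (n - i)))
      = (\<Sum>i\<in>{1..n}. (-1) ^ n * fact n * (e i * c (n - i)))"
    by (rule sum.mono_neutral_right) (auto simp: e_def)
  ultimately show ?thesis
    unfolding distrib_left sum_distrib_left pole
    by (simp only: Lmon_def poly_add poly_sum poly_monom)
qed

lemma laurent_fin_pole:
  assumes "r > 0" "\<And>z. 0 < Re z \<Longrightarrow> norm z < r \<Longrightarrow> (\<lambda>n. c n * z ^ n) sums (F z - c0 / z)"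
  shows "fin_pole F"
proof -
  have "(\<lambda>z. F z - c0 / z) \<in> O[half_nhds_0](\<lambda>z. z ^ 0)"
    by (rule powser_tail_bigo[where a = c and r = r]) (use assms in auto)
  moreover have "(\<lambda>z. 1::complex) \<in> O[half_nhds_0](\<lambda>z. 1 / z)"
  proof (rule bigoI[where c = 1])
    show "eventually (\<lambda>z. norm (1::complex) \<le> 1 * norm (1 / z)) half_nhds_0"
      by (auto simp: eventually_at norm_divide divide_simps intro!: exI[of _ 1])
  qed
  ultimately have "(\<lambda>z. F z - c0 / z) \<in> O[half_nhds_0](\<lambda>z. 1 / z)"
    using landau_o.big_trans by auto
  moreover have "(\<lambda>z. c0 / z) \<in> O[half_nhds_0](\<lambda>z. 1 / z)"
    by (rule bigoI[where c = "norm c0"]) (simp add: norm_divide)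
  ultimately have "(\<lambda>z. (F z - c0 / z) + c0 / z) \<in> O[half_nhds_0](\<lambda>z. 1 / z)"
    by (rule sum_in_bigo)
  then show ?thesis unfolding fin_pole_def by (intro exI[of _ 1]) simp
qed

section \<open>Grafting under the renormalized rule\<close>

text \<open>The inverse identity expresses the inverse character on a grafted forest through values
  on smaller ones. Inserted in the convolution, it subtracts the integrand at scale
  \<open>\<mu>\<close>, whence the \<open>- 1\<close>.\<close>

lemma phiR_Node:
  assumes "is_antipodeH S" "\<mu> > 0"
  shows "phiR F S \<mu> (\<mu> * exp l) {#Node w#} z
    = (\<Sum>p\<in>Poly_Mapping.keys (copH w).
        (of_real (Poly_Mapping.lookup (copH w) p) * lin (\<lambda>k. phi F \<mu> k z) (S (fst p))
          * phi F \<mu> (snd p) z * of_real \<mu> powr (- z))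
        * (F (z * of_nat (Suc (fnodes (snd p))))
          * (exp (- of_real l * (z * of_nat (Suc (fnodes (snd p))))) - 1)))"
proof -
  define \<psi> where "\<psi> k = lin (\<lambda>k. phi F \<mu> k z) (S k)" for k
  have "conv \<psi> (\<lambda>k. phi F \<mu> k z) {#Node w#} = 0"
    using antipode_left_inverse[of S "\<lambda>k. phi F \<mu> k z" "{#Node w#}"] assms
    by (simp add: \<psi>_def[abs_def] phi_add counitH_def)
  then have \<psi>_Node: "\<psi> {#Node w#} = - lin (\<lambda>p. \<psi> (fst p) * phi F \<mu> {#Node (snd p)#} z) (copH w)"
    using assms(2) by (simp add: conv_def lin_copH_Node add_eq_0_iff2)
  have "phiR F S \<mu> (\<mu> * exp l) {#Node w#} z
      = lin (\<lambda>p. \<psi> (fst p) * phi F (\<mu> * exp l) {#Node (snd p)#} z) (copH w)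
        - lin (\<lambda>p. \<psi> (fst p) * phi F \<mu> {#Node (snd p)#} z) (copH w)"
    unfolding phiR_eq_conv conv_def lin_copH_Node \<psi>_def[symmetric]
    using assms(2) by (simp add: \<psi>_Node)
  then show ?thesis
    unfolding phi_scale[OF assms(2)] fnodes_Node phi_Node[of F \<mu>] \<psi>_def[symmetric]
    by (simp add: lin_def sum_subtractf[symmetric] scaleR_conv_of_real algebra_simps)
qed

lemma tendsto_phiR_Node:
  assumes S: "is_antipodeH S" and \<mu>: "\<mu> > 0" and "r > 0"
    and laurent: "\<And>z. 0 < Re z \<Longrightarrow> norm z < r \<Longrightarrow>
      (\<lambda>n. of_real (c n) * z ^ n) sums (F z - of_real cm1 / z)"
    and lim: "\<And>l. (phiR F S \<mu> (\<mu> * exp l) w \<longlongrightarrow> of_real (poly p l)) half_nhds_0"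
  shows "(phiR F S \<mu> (\<mu> * exp l) {#Node w#} \<longlongrightarrow> of_real (poly (Lop cm1 c p) l)) half_nhds_0"
proof -
  define K where "K = Poly_Mapping.keys (copH w)"
  define A where "A p z = of_real (Poly_Mapping.lookup (copH w) p) * lin (\<lambda>k. phi F \<mu> k z) (S (fst p))
      * phi F \<mu> (snd p) z * of_real \<mu> powr (- z)" for p z
  define E where "E i = (if i = 0 then 0 else (- complex_of_real l) ^ i / fact i)" for i
  have powr_lim: "((\<lambda>z. of_real \<mu> powr (- z)) \<longlongrightarrow> 1) half_nhds_0"
    using tendsto_powr_complex[of "of_real \<mu>" "\<lambda>_. of_real \<mu>" half_nhds_0 uminus 0] \<mu> tendsto_minus[OF tendsto_ident_at, of "0::complex"]
    by simp
  have F_pole: "fin_pole F" using \<open>r > 0\<close> laurent by (rule laurent_fin_pole)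
  have A_pole: "fin_pole (A p)" for p
    unfolding A_def[abs_def] lin_def scaleR_conv_of_real
    by (intro fin_pole_mult fin_pole_sum fin_pole_phi F_pole \<mu> fin_pole_tendsto[OF powr_lim]
        fin_pole_tendsto[OF tendsto_const]) auto
  \<comment> \<open>The exponents also count the new root; the extra factors
    \<open>\<mu> powr (- z)\<close> and \<open>exp (- l * z)\<close> tend to \<open>1\<close> and
    leave the limit for \<open>w\<close> unchanged.\<close>
  have exp_lim: "((\<lambda>z. \<Sum>p\<in>K. A p z * exp (- of_real l * (z * of_nat (Suc (fnodes (snd p))))))
      \<longlongrightarrow> of_real (poly p l)) half_nhds_0" for l
  proof -
    have "((\<lambda>z. phiR F S \<mu> (\<mu> * exp l) w z * of_real \<mu> powr (- z) * exp (- of_real l * z))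
        \<longlongrightarrow> of_real (poly p l) * 1 * exp (- of_real l * 0)) half_nhds_0"
      by (intro tendsto_intros lim powr_lim)
    moreover have "phiR F S \<mu> (\<mu> * exp l) w z * of_real \<mu> powr (- z) * exp (- of_real l * z)
        = (\<Sum>p\<in>K. A p z * exp (- of_real l * (z * of_nat (Suc (fnodes (snd p))))))" for z
      unfolding phiR_eq_conv conv_def lin_def[of _ "copH w"] sum_distrib_right K_def
      by (intro sum.cong refl)
        (simp add: A_def phi_scale[OF \<mu>] scaleR_conv_of_real exp_add exp_diff exp_minus algebra_simps divide_simps)
    ultimately show ?thesis by simp
  qed
  have "((\<lambda>z. \<Sum>p\<in>K. A p z * (F (z * of_nat (Suc (fnodes (snd p))))
          * (exp (- of_real l * (z * of_nat (Suc (fnodes (snd p))))) - 1)))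
      \<longlongrightarrow> (\<Sum>n\<le>degree p. of_real (coeff p n) * ((-1) ^ n * fact n *
          (of_real cm1 * E (Suc n) + (\<Sum>i\<le>n. E i * of_real (c (n - i))))))) half_nhds_0"
  \<comment> \<open>The \<open>l\<close> inside \<open>g\<close> is fixed, while
    \<open>exp_lim\<close> supplies the hypothesis for every real parameter.\<close>
  proof (rule tendsto_sum_powser[where g = "\<lambda>x. F x * (exp (- of_real l * x) - 1)"
        and m = "\<lambda>p. Suc (fnodes (snd p))", OF _ _ _ exp_lim \<open>r > 0\<close>])
    show "(\<lambda>n. (of_real cm1 * E (Suc n) + (\<Sum>i\<le>n. E i * of_real (c (n - i)))) * x ^ n)
        sums (F x * (exp (- of_real l * x) - 1))" if "x \<in> {z. 0 < Re z}" "norm x < r" for x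
      unfolding E_def by (rule laurent_times_exp_minus_1_sums[OF laurent]) (use that in auto)
  qed (use A_pole in \<open>auto simp: K_def fin_pole_def\<close>)
  moreover have "(\<Sum>n\<le>degree p. of_real (coeff p n) * ((-1) ^ n * fact n *
          (of_real cm1 * E (Suc n) + (\<Sum>i\<le>n. E i * of_real (c (n - i))))))
      = of_real (poly (Lop cm1 c p) l)"
  proof -
    have "E = (\<lambda>i. of_real (if i = 0 then 0 else (- l) ^ i / fact i))"
      by (auto simp: E_def)
    then show ?thesis
      unfolding Lop_def poly_sum poly_smult poly_Lmon_eq_cauchy_coeff by simp
  qed
  moreover have "phiR F S \<mu> (\<mu> * exp l) {#Node w#} = (\<lambda>z. \<Sum>p\<in>K. A p z * (F (z * of_nat (Suc (fnodes (snd p))))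
          * (exp (- of_real l * (z * of_nat (Suc (fnodes (snd p))))) - 1)))"
    unfolding A_def K_def by (rule ext) (rule phiR_Node[OF S \<mu>])
  ultimately show ?thesis by (simp only:)
qed

section \<open>The limit is a Hopf algebra morphism\<close>

lemma phiL_empty: "phiL L {#} = 1"
  by (simp add: phiL_def)

lemma phiL_add: "phiL L (a + b) = phiL L a * phiL L b"
  by (simp add: phiL_def)

lemma phiL_Node: "phiL L {#Node w#} = L (phiL L w)"
  by (simp add: phiL_def)

lemma poly_phiL_0: "poly (phiL (Lop cm1 c) w) 0 = counitH w"
  by (induction w rule: forest_induct)
    (auto simp: phiL_empty phiL_add phiL_Node poly_Lop_0 counitH_def)

text \<open>Compatibility with coproducts, as an identity of functions. In the grafting case the
  hypothesis for all \<open>y\<close> is an identity of polynomials, to which \<open>Lop\<close>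
  applies; its translation rule then matches \<open>lin_copH_Node\<close>.\<close>

lemma poly_phiL_shift:
  "poly (phiL (Lop cm1 c) w) (x + y)
    = conv (\<lambda>k. poly (phiL (Lop cm1 c) k) x) (\<lambda>k. poly (phiL (Lop cm1 c) k) y) w"
proof (induction w arbitrary: y rule: forest_induct)
  case empty
  then show ?case by (simp add: conv_def phiL_empty)
next
  case (add a b)
  then show ?case by (simp add: conv_mult phiL_add)
next
  case (graft w)
  let ?L = "Lop cm1 c" and ?P = "phiL (Lop cm1 c)"
  have "?P w \<circ>\<^sub>p [:x, 1:] = (\<Sum>p\<in>Poly_Mapping.keys (copH w).
      smult (Poly_Mapping.lookup (copH w) p * poly (?P (fst p)) x) (?P (snd p)))"
    by (rule poly_ext) (simp add: poly_pcompose graft conv_def lin_def poly_sum mult.assoc)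
  then have "poly (?L (?P w \<circ>\<^sub>p [:x, 1:])) y
      = lin (\<lambda>p. poly (?P (fst p)) x * poly (?P {#Node (snd p)#}) y) (copH w)"
    by (simp add: Lop_sum Lop_smult poly_sum lin_def phiL_Node mult.assoc)
  then show ?case
    by (simp add: conv_def lin_copH_Node phiL_empty phiL_Node Lop_shift poly_pcompose)
qed

lemma copX_phiL:
  "copX (phiL (Lop cm1 c) w) = (\<Sum>p\<in>Poly_Mapping.keys (copH w).
     ptens (smult (Poly_Mapping.lookup (copH w) p) (phiL (Lop cm1 c) (fst p))) (phiL (Lop cm1 c) (snd p)))"
  by (rule ev2_inject)
    (simp only: ev2_copX poly_phiL_shift ev2_sum ev2_ptens conv_def lin_def poly_smult real_scaleR_def mult.assoc)

text \<open>Evaluation at \<open>x\<close> after the antipode and evaluation at \<open>- x\<close>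
  are both left inverses of evaluation at \<open>x\<close>, the latter because the arguments add to
  \<open>0\<close>.\<close>

lemma phiL_antipode:
  assumes "is_antipodeH S"
  shows "linHpoly (phiL (Lop cm1 c)) (S w) = antipodeX (phiL (Lop cm1 c) w)"
proof (rule poly_ext)
  fix x
  let ?P = "\<lambda>x k. poly (phiL (Lop cm1 c) k) x"
  have "conv (\<lambda>w. lin (?P x) (S w)) (?P x) w = counitH w" for w
    using antipode_left_inverse[OF assms, of "?P x"] by (simp add: phiL_add phiL_empty)
  moreover have "conv (?P (- x)) (?P x) w = counitH w" for w
    using poly_phiL_shift[of cm1 c w "- x" x] by (simp add: poly_phiL_0)
  ultimately have "lin (?P x) (S w) - ?P (- x) w = 0"
    by (intro conv_eq_0_imp[of "\<lambda>w. lin (?P x) (S w) - ?P (- x) w" "?P x"])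
      (simp_all add: conv_diff phiL_empty)
  then show "poly (linHpoly (phiL (Lop cm1 c)) (S w)) x = poly (antipodeX (phiL (Lop cm1 c) w)) x"
    by (simp add: linHpoly_def antipodeX_def poly_pcompose poly_sum lin_def)
qed

section \<open>Multiplicativity of the renormalized rule and conclusion\<close>

lemma phiR_empty:
  assumes "is_antipodeH S" "\<mu> > 0" "s > 0"
  shows "phiR F S \<mu> s {#} = (\<lambda>z. 1)"
proof
  fix z
  \<comment> \<open>On the empty forest the rules at \<open>s\<close> and \<open>\<mu>\<close>
    agree, so the inverse identity at scale \<open>\<mu>\<close> gives the value.\<close>
  have "conv (\<lambda>k. lin (\<lambda>k. phi F \<mu> k z) (S k)) (\<lambda>k. phi F \<mu> k z) {#} = of_real (counitH {#})"
    using assms by (intro antipode_left_inverse) (simp_all add: phi_add)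
  then show "phiR F S \<mu> s {#} z = 1"
    using assms by (simp add: phiR_eq_conv conv_def counitH_def)
qed

text \<open>\<open>is_antipodeH\<close> does not state multiplicativity of \<open>S\<close>;
  composed with the rule at \<open>\<mu>\<close> it is multiplicative as the left inverse of a
  character.\<close>

lemma phiR_add:
  assumes "is_antipodeH S" "\<mu> > 0"
  shows "phiR F S \<mu> s (a + b) = (\<lambda>z. phiR F S \<mu> s a z * phiR F S \<mu> s b z)"
proof
  fix z
  define \<phi> where "\<phi> k = phi F \<mu> k z" for k
  have \<phi>: "\<phi> (a + b) = \<phi> a * \<phi> b" "\<phi> {#} = 1" for a b
    using assms by (simp_all add: \<phi>_def phi_add)
  have "lin \<phi> (S (a + b)) = lin \<phi> (S a) * lin \<phi> (S b)" for a b
    using left_inverse_mult[OF antipode_left_inverse[OF assms(1) \<phi>] \<phi>] .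
  then show "phiR F S \<mu> s (a + b) z = phiR F S \<mu> s a z * phiR F S \<mu> s b z"
    unfolding phiR_eq_conv \<phi>_def[symmetric] by (intro conv_mult phi_add)
qed

theorem mainTheorem7:
  fixes f :: "real \<Rightarrow> real" and c :: real and \<mu> :: real
    and cm1 :: real and cn :: "nat \<Rightarrow> real"
    and S :: "forest \<Rightarrow> HR" and P :: "forest \<Rightarrow> real poly"
  assumes f_cont: "continuous_on {0..} f"
    and f_asym: "\<exists>\<epsilon>>0. (\<lambda>\<zeta>. f \<zeta> - c / \<zeta>) \<in> O[at_top](\<lambda>\<zeta>. \<zeta> powr (- 1 - \<epsilon>))"
    and laurent: "\<exists>r>0. \<forall>z. 0 < Re z \<and> norm z < r \<longrightarrow>
         ((\<lambda>n. complex_of_real (cn n) * z ^ n) sums (mellin f z - complex_of_real cm1 / z))"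
    and mu_pos: "\<mu> > 0"
    and S_antipode: "is_antipodeH S"
    and P_def: "\<forall>w s. s > 0 \<longrightarrow>
         (phiR (mellin f) S \<mu> s w \<longlongrightarrow> complex_of_real (poly (P w) (ln (s / \<mu>))))
           (at 0 within {z. 0 < Re z})"
  shows "is_1cocycleX (Lop cm1 cn)
    \<and> (\<forall>w. P w = phiL (Lop cm1 cn) w)
    \<and> P {#} = 1 \<and> (\<forall>a b. P (a + b) = P a * P b)
    \<and> (\<forall>w. copX (P w) = (\<Sum>p\<in>Poly_Mapping.keys (copH w).
            ptens (smult (Poly_Mapping.lookup (copH w) p) (P (fst p))) (P (snd p))))
    \<and> (\<forall>w. counitX (P w) = counitH w)
    \<and> (\<forall>w. linHpoly P (S w) = antipodeX (P w))"
proof -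
  let ?R = "\<lambda>l. phiR (mellin f) S \<mu> (\<mu> * exp l)"
  obtain r where "r > 0" and r: "\<And>z. 0 < Re z \<Longrightarrow> norm z < r \<Longrightarrow>
      (\<lambda>n. complex_of_real (cn n) * z ^ n) sums (mellin f z - complex_of_real cm1 / z)"
    using laurent by blast
  have lim: "(?R l w \<longlongrightarrow> of_real (poly (P w) l)) half_nhds_0" for l w
    using P_def[rule_format, of "\<mu> * exp l" w] mu_pos by simp
  \<comment> \<open>As \<open>s\<close> runs through the positive reals, \<open>l\<close> runs
    through all reals, so unique limits determine the polynomial.\<close>
  have P_eqI: "P w = q" if "\<And>l. (?R l w \<longlongrightarrow> of_real (poly q l)) half_nhds_0" for w q
    using tendsto_unique[OF half_nhds_0_neq_bot lim that] by (intro poly_ext) simp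
  have P_phiL: "P w = phiL (Lop cm1 cn) w" for w
  proof (induction w rule: forest_induct)
    case empty
    then show ?case using S_antipode mu_pos by (intro P_eqI) (simp add: phiR_empty phiL_empty)
  next
    case (add a b)
    have "P (a + b) = P a * P b"
      using tendsto_mult[OF lim[of _ a] lim[of _ b]] S_antipode mu_pos
      by (intro P_eqI) (simp add: phiR_add)
    then show ?case using add by (simp add: phiL_add)
  next
    case (graft w)
    have "P {#Node w#} = Lop cm1 cn (P w)"
      using tendsto_phiR_Node[OF S_antipode mu_pos \<open>r > 0\<close> r lim] by (rule P_eqI)
    then show ?case using graft by (simp add: phiL_Node)
  qed
  then have "P = phiL (Lop cm1 cn)" ..
  then show ?thesis
    by (simp add: is_1cocycleX_Lop phiL_empty phiL_add copX_phiL counitX_def poly_phiL_0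
        phiL_antipode[OF S_antipode])
qed

end
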